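(* Let $n\ge 1$, let $r=(r_1,\ldots,r_n)$ with $r_i>0$ for $i=1,\ldots,n$, and let $\ell:\mathbb{R}[\underline{X}]\to\mathbb{R}$ be a linear functional such that the sequence $s(\alpha)=\ell(\underline{X}^\alpha)$, $\alpha\in\mathbb{N}^n$, satisfies $$\sup_{\alpha\in\mathbb{N}^n}|s(\alpha)|\,r_1^{-\alpha_1}\cdots r_n^{-\alpha_n}<\infty.$$ Then $\ell$ is positive semidefinite if and only if there exists a positive Borel measure $\mu$ on $K=\prod_{i=1}^n[-r_i,r_i]$ such that $\ell(f)=\int_K f\,d\mu$ for all $f\in\mathbb{R}[\underline{X}]$.
   Context: Here $\mathbb{R}[\underline{X}]=\mathbb{R}[X_1,\ldots,X_n]$, $\mathbb{N}=\{0,1,2,\ldots\}$, and $\underline{X}^\alpha=X_1^{\alpha_1}\cdots X_n^{\alpha_n}$. A linear functional $\ell:\mathbb{R}[\underline{X}]\to\mathbb{R}$ is positive semidefinite if $\ell(h^2)\ge 0$ for every $h\in\mathbb{R}[\underline{X}]$. Representation of $\ell$ by a measure $\mu$ includes that all polynomials are $\mu$-integrable. *)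

theory Defs
  imports "HOL-Analysis.Analysis" "HOL-Library.Poly_Mapping"
begin

text \<open>
  A multi-index is a finitely supported function on the variable index type; as that type is
  finite, there is no restriction. The ring structure of polynomials is the convolution product
  of \<^theory>\<open>HOL-Library.Poly_Mapping\<close>.
\<close>

type_synonym 'n mindex = "'n \<Rightarrow>\<^sub>0 nat"
type_synonym 'n rpoly = "'n mindex \<Rightarrow>\<^sub>0 real"

definition poly_scale :: "real \<Rightarrow> 'n rpoly \<Rightarrow> 'n rpoly" where
  "poly_scale c p = Poly_Mapping.map ((*) c) p"

definition monomial :: "'n mindex \<Rightarrow> 'n rpoly" where
  "monomial \<alpha> = Poly_Mapping.single \<alpha> 1"

definition poly_eval :: "'n::finite rpoly \<Rightarrow> real ^ 'n \<Rightarrow> real" where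
  "poly_eval p x = (\<Sum>\<alpha>\<in>Poly_Mapping.keys p.
      Poly_Mapping.lookup p \<alpha> * (\<Prod>i\<in>UNIV. (x $ i) ^ Poly_Mapping.lookup \<alpha> i))"

definition linear_functional :: "('n rpoly \<Rightarrow> real) \<Rightarrow> bool" where
  "linear_functional L \<longleftrightarrow> Vector_Spaces.linear poly_scale (*) L"

definition psd_functional :: "('n rpoly \<Rightarrow> real) \<Rightarrow> bool" where
  "psd_functional L \<longleftrightarrow> (\<forall>h. 0 \<le> L (h\<^sup>2))"

text \<open>
  A positive Borel measure on \<open>K\<close> is a measure with space \<open>K\<close> whose measurable sets are the
  Borel subsets of \<open>K\<close>.
\<close>

definition represents_on ::
    "('n::finite rpoly \<Rightarrow> real) \<Rightarrow> (real ^ 'n) set \<Rightarrow> (real ^ 'n) measure \<Rightarrow> bool" where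
  "represents_on L K \<mu> \<longleftrightarrow>
     sets \<mu> = sets (restrict_space borel K) \<and>
     (\<forall>f. integrable \<mu> (poly_eval f) \<and> L f = (\<integral>x. poly_eval f x \<partial>\<mu>))"

lemma lookup_poly_scale:
  "Poly_Mapping.lookup (poly_scale c p) \<alpha> = c * Poly_Mapping.lookup p \<alpha>"
  by (simp add: poly_scale_def Poly_Mapping.map.rep_eq when_def)

lemma vector_space_poly_scale: "vector_space poly_scale"
  by (rule vector_space.intro; rule poly_mapping_eqI;
      simp add: lookup_poly_scale lookup_add algebra_simps)

lemma linear_functional_iff:
  "linear_functional L \<longleftrightarrow>
     (\<forall>p q. L (p + q) = L p + L q) \<and> (\<forall>c p. L (poly_scale c p) = c * L p)"
  using vector_space_poly_scale vector_space_over_itself.vector_space_axioms[where 'a = real]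
  unfolding linear_functional_def Vector_Spaces.linear_iff by blast

lemma monomial_times: "monomial \<alpha> * monomial \<beta> = monomial (\<alpha> + \<beta>)"
  by (simp add: monomial_def mult_single)

lemma poly_eval_monomial:
  "poly_eval (monomial \<alpha>) x = (\<Prod>i\<in>UNIV. (x $ i) ^ Poly_Mapping.lookup \<alpha> i)"
  by (simp add: poly_eval_def monomial_def)

end

theory Submission
  imports Defs "HOL-Probability.Probability" "HOL-Real_Asymp.Real_Asymp"
begin

text \<open>
  If \<open>\<ell>\<close> is integration of polynomials against a measure, then \<open>\<ell>(h\<^sup>2)\<close> is the integral of a square.
  The converse has three steps.

  \<^bold>\<open>Positivity.\<close> Call \<open>\<ell>\<close> bounded if \<open>|\<ell>(X\<^sup>\<alpha>)| \<le> C r\<^sup>\<alpha>\<close>. For a positive semidefinite bounded \<open>\<ell>\<close>,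
  iterating the Cauchy-Schwarz inequality \<open>\<ell>(f)\<^sup>2 \<le> \<ell>(1) \<ell>(f\<^sup>2)\<close> along \<open>X\<^sub>i, X\<^sub>i\<^sup>2, X\<^sub>i\<^sup>4, \<dots>\<close> and taking
  \<open>2\<^sup>k\<close>-th roots gives \<open>|\<ell>(X\<^sub>i)| \<le> r\<^sub>i \<ell>(1)\<close> (lemma \<open>coord_bound\<close>). Applied to \<open>f \<mapsto> \<ell>(h\<^sup>2 f)\<close>, this
  says that \<open>f \<mapsto> \<ell>((r\<^sub>i \<plusminus> X\<^sub>i) f)\<close> is again positive semidefinite, and it is clearly
  bounded again. Hence multiplication by \<open>r\<^sub>i \<plusminus> X\<^sub>i\<close> can be repeated, and \<open>\<ell>\<close> is nonnegative on all
  products of such factors (lemma \<open>bernstein_nonneg\<close>).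

  \<^bold>\<open>Discretisation.\<close> In the coordinates \<open>T\<^sub>i = (r\<^sub>i + X\<^sub>i) / (2 r\<^sub>i)\<close>, which turn the box into the unit
  cube, the values of \<open>\<ell>\<close> on the Bernstein products of degree \<open>m\<close> are nonnegative weights on the
  grid \<open>{0, 1/m, \<dots>, 1}\<^sup>n\<close>. As \<open>m\<close> grows, the moments of these discrete measures converge to
  \<open>\<ell>(T\<^sup>a)\<close> (lemma \<open>bernstein_grid_moment_tendsto\<close>).

  \<^bold>\<open>Compactness.\<close> A weak limit of the discrete measures is the desired measure. To obtain it from
  Helly's selection theorem on the real line, the grid points are lifted to \<open>[0, 1]\<close> along a
  continuous surjection of \<open>[0, 1]\<close> onto the cube, Schoenberg's space-filling curve. A limit of the
  lifted measures is then pushed forward again (lemma \<open>convergent_subsequence_of_point_measures\<close>).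
\<close>

section \<open>Polynomials and linear functionals\<close>

lemma poly_scale_eq_times: "poly_scale c p = Poly_Mapping.single 0 c * p"
  unfolding poly_scale_def by (rule mult_map_scale_conv_mult)

lemma poly_scale_monomial: "poly_scale c (monomial \<alpha>) = Poly_Mapping.single \<alpha> c"
  by (simp add: poly_scale_eq_times monomial_def mult_single)

lemma poly_scale_times: "poly_scale c p * q = poly_scale c (p * q)"
  and times_poly_scale: "p * poly_scale c q = poly_scale c (p * q)"
  by (simp_all add: poly_scale_eq_times mult_ac)

lemma poly_scale_poly_scale: "poly_scale c (poly_scale d p) = poly_scale (c * d) p"
  by (rule poly_mapping_eqI) (simp add: lookup_poly_scale)

lemma poly_scale_1 [simp]: "poly_scale 1 p = p"
  by (rule poly_mapping_eqI) (simp add: lookup_poly_scale)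

lemma poly_scale_of_nat: "poly_scale (of_nat k) p = of_nat k * p"
  by (induction k) (auto simp: poly_scale_eq_times single_add ring_distribs)

lemma monomial_0 [simp]: "monomial 0 = 1"
  by (simp add: monomial_def)

text \<open>
  A polynomial is the sum of its terms. The empty sum is covered by the scalar \<open>c = 0\<close>.
\<close>

lemma rpoly_induct [case_names scaled_monomial add]:
  fixes p :: "'n rpoly"
  assumes mono: "\<And>c \<alpha>. P (poly_scale c (monomial \<alpha>))"
    and add: "\<And>p q. P p \<Longrightarrow> P q \<Longrightarrow> P (p + q)"
  shows "P p"
proof -
  have "P (\<Sum>\<alpha>\<in>A. poly_scale (Poly_Mapping.lookup p \<alpha>) (monomial \<alpha>))" if "finite A" for A
    using that
  proof induction
    case empty
    show ?case using mono[of 0 0] by (simp only: poly_scale_monomial single_zero sum.empty)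
  qed (simp_all add: mono add)
  moreover have "p = (\<Sum>\<alpha>\<in>Poly_Mapping.keys p. poly_scale (Poly_Mapping.lookup p \<alpha>) (monomial \<alpha>))"
    by (rule poly_mapping_eqI)
       (simp add: poly_scale_monomial lookup_sum lookup_single when_def in_keys_iff)
  ultimately show ?thesis by (metis finite_keys)
qed

definition coord :: "'n \<Rightarrow> 'n rpoly" where
  "coord i = monomial (Poly_Mapping.single i 1)"

text \<open>
  The number \<open>r\<^sup>\<alpha>\<close>, the value of the monomial \<open>X\<^sup>\<alpha>\<close> at the point \<open>r\<close>.
\<close>

definition weight :: "real ^ 'n::finite \<Rightarrow> 'n mindex \<Rightarrow> real" where
  "weight r \<alpha> = (\<Prod>i\<in>UNIV. (r $ i) ^ Poly_Mapping.lookup \<alpha> i)"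

lemma weight_add: "weight r (\<alpha> + \<beta>) = weight r \<alpha> * weight r \<beta>"
  by (simp add: weight_def lookup_add power_add prod.distrib)

lemma weight_single: "weight r (Poly_Mapping.single i k) = (r $ i) ^ k"
proof -
  have "weight r (Poly_Mapping.single i k) = (\<Prod>j\<in>UNIV. if j = i then (r $ i) ^ k else 1)"
    unfolding weight_def by (rule prod.cong) (auto simp: lookup_single when_def)
  thus ?thesis by simp
qed

lemma coord_power: "coord i ^ k = monomial (Poly_Mapping.single i k)"
  by (induction k) (simp_all add: coord_def monomial_times flip: single_add)

lemma linear_functionalD:
  assumes "linear_functional L"
  shows "L (p + q) = L p + L q" "L (poly_scale c p) = c * L p" "L 0 = 0" "L (- p) = - L p"
    "L (p - q) = L p - L q" "L (sum f A) = (\<Sum>a\<in>A. L (f a))"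
proof -
  show add: "L (p + q) = L p + L q" and scale: "L (poly_scale c p) = c * L p" for p q c
    using assms by (auto simp: linear_functional_iff)
  show 0: "L 0 = 0" using add[of 0 0] by simp
  show neg: "L (- p) = - L p" for p using add[of p "- p"] 0 by simp
  show "L (p - q) = L p - L q" using add[of p "- q"] neg by simp
  show "L (sum f A) = (\<Sum>a\<in>A. L (f a))"
    by (induction A rule: infinite_finite_induct) (simp_all add: add 0)
qed

lemma linear_functional_shift:
  assumes "linear_functional L"
  shows "linear_functional (\<lambda>f. L (p * f))"
  unfolding linear_functional_iff
  by (simp add: linear_functionalD[OF assms] ring_distribs times_poly_scale)

definition growth_bounded :: "real ^ 'n::finite \<Rightarrow> ('n rpoly \<Rightarrow> real) \<Rightarrow> bool" where
  "growth_bounded r L \<longleftrightarrow> (\<exists>C. \<forall>\<alpha>. \<bar>L (monomial \<alpha>)\<bar> \<le> C * weight r \<alpha>)"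

text \<open>
  Multiplying by \<open>X\<^sup>\<beta>\<close> shifts the moments, which costs the constant factor \<open>r\<^sup>\<beta>\<close>. A general
  multiplier adds up finitely many such constants.
\<close>

lemma growth_bounded_shift:
  fixes L :: "'n::finite rpoly \<Rightarrow> real"
  assumes L: "linear_functional L" "growth_bounded r L"
  shows "growth_bounded r (\<lambda>f. L (p * f))"
proof (induction p rule: rpoly_induct)
  case (scaled_monomial c \<beta>)
  from L(2) obtain C where C: "\<bar>L (monomial \<alpha>)\<bar> \<le> C * weight r \<alpha>" for \<alpha>
    by (auto simp: growth_bounded_def)
  have "\<bar>L (poly_scale c (monomial \<beta>) * monomial \<alpha>)\<bar> \<le> (\<bar>c\<bar> * C * weight r \<beta>) * weight r \<alpha>" for \<alpha>
    using mult_left_mono[OF C[of "\<beta> + \<alpha>"] abs_ge_zero[of c]]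
    unfolding poly_scale_times monomial_times
    by (simp add: linear_functionalD[OF L(1)] abs_mult weight_add algebra_simps)
  thus ?case unfolding growth_bounded_def by blast
next
  case (add p q)
  then obtain C D where "\<bar>L (p * monomial \<alpha>)\<bar> \<le> C * weight r \<alpha>"
    and "\<bar>L (q * monomial \<alpha>)\<bar> \<le> D * weight r \<alpha>" for \<alpha>
    by (auto simp: growth_bounded_def)
  hence "\<bar>L ((p + q) * monomial \<alpha>)\<bar> \<le> (C + D) * weight r \<alpha>" for \<alpha>
    by (simp add: ring_distribs linear_functionalD[OF L(1)] abs_triangle_ineq order_trans[OF abs_triangle_ineq] add_mono)
  thus ?case unfolding growth_bounded_def by blast
qed

lemma poly_eval_superset:
  assumes "finite S" "Poly_Mapping.keys p \<subseteq> S"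
  shows "poly_eval p x = (\<Sum>\<alpha>\<in>S. Poly_Mapping.lookup p \<alpha> * weight x \<alpha>)"
  unfolding poly_eval_def weight_def
  by (rule sum.mono_neutral_left) (use assms in \<open>auto simp: in_keys_iff\<close>)

lemma poly_eval_add: "poly_eval (p + q) x = poly_eval p x + poly_eval q x"
proof -
  let ?S = "Poly_Mapping.keys p \<union> Poly_Mapping.keys q"
  have "poly_eval (p + q) x = (\<Sum>\<alpha>\<in>?S. Poly_Mapping.lookup (p + q) \<alpha> * weight x \<alpha>)"
    by (intro poly_eval_superset keys_add) simp
  also have "\<dots> = poly_eval p x + poly_eval q x"
    by (simp add: lookup_add distrib_right sum.distrib poly_eval_superset[of ?S])
  finally show ?thesis .
qed

lemma poly_eval_scale: "poly_eval (poly_scale c p) x = c * poly_eval p x"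
proof -
  have "poly_eval (poly_scale c p) x
      = (\<Sum>\<alpha>\<in>Poly_Mapping.keys p. Poly_Mapping.lookup (poly_scale c p) \<alpha> * weight x \<alpha>)"
    by (rule poly_eval_superset) (auto simp: in_keys_iff lookup_poly_scale)
  also have "\<dots> = c * poly_eval p x"
    by (simp add: lookup_poly_scale poly_eval_def weight_def sum_distrib_left mult_ac)
  finally show ?thesis .
qed

lemma poly_eval_monomial_weight: "poly_eval (monomial \<alpha>) x = weight x \<alpha>"
  by (simp add: poly_eval_monomial weight_def)

lemma poly_eval_mult: "poly_eval (p * q) x = poly_eval p x * poly_eval q x"
proof (induction p rule: rpoly_induct)
  case (scaled_monomial c \<alpha>)
  show ?case
  proof (induction q rule: rpoly_induct)
    case (scaled_monomial d \<beta>)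
    show ?case
      unfolding poly_scale_times times_poly_scale monomial_times poly_eval_scale
        poly_eval_monomial_weight weight_add by simp
  next
    case (add p q)
    thus ?case by (simp add: distrib_left poly_eval_add)
  qed
next
  case (add p q)
  thus ?case by (simp add: distrib_right poly_eval_add)
qed

lemma poly_eval_1: "poly_eval 1 x = 1"
  using poly_eval_monomial_weight[of 0 x] by (simp add: weight_def)

lemma poly_eval_coord: "poly_eval (coord i) x = x $ i"
  by (simp add: coord_def poly_eval_monomial_weight weight_single)

lemma continuous_on_poly_eval: "continuous_on A (poly_eval p)"
proof -
  have "continuous_on A (\<lambda>x. poly_eval p x)"
    unfolding poly_eval_def by (intro continuous_intros)
  thus ?thesis by simp
qed

lemma monomial_eq_prod_coord:
  fixes \<alpha> :: "'n::finite mindex"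
  shows "monomial \<alpha> = (\<Prod>i\<in>UNIV. coord i ^ Poly_Mapping.lookup \<alpha> i)"
proof -
  have "(\<Prod>i\<in>A. monomial (f i)) = monomial (\<Sum>i\<in>A. f i)" if "finite A" for A and f :: "'n \<Rightarrow> 'n mindex"
    using that by induction (simp_all add: monomial_times)
  moreover have "(\<Sum>i\<in>UNIV. Poly_Mapping.single i (Poly_Mapping.lookup \<alpha> i)) = \<alpha>"
    by (rule poly_mapping_eqI) (simp add: lookup_sum lookup_single when_def)
  ultimately show ?thesis by (simp add: coord_power)
qed

section \<open>Positivity of Bernstein products\<close>

text \<open>
  If \<open>u > 0\<close>, take \<open>(a, b) = (- v, u)\<close>. If \<open>u = 0\<close>, the form is affine in \<open>a\<close> for \<open>b = 1\<close>, so the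
  slope \<open>v\<close> must vanish.
\<close>

lemma nonneg_quadratic_form_imp_discriminant:
  fixes u v w :: real
  assumes q: "\<And>a b. 0 \<le> a\<^sup>2 * u + 2 * a * b * v + b\<^sup>2 * w"
  shows "v\<^sup>2 \<le> u * w"
proof -
  have u: "0 \<le> u" using q[of 1 0] by simp
  show ?thesis
  proof (cases "u = 0")
    case True
    have "v = 0"
    proof (rule ccontr)
      assume "v \<noteq> 0"
      thus False using q[of "- (w + 1) / (2 * v)" 1] True by (simp add: field_simps)
    qed
    thus ?thesis using True by simp
  next
    case False
    have "0 \<le> u * (u * w - v\<^sup>2)"
      using q[of "- v" u] by (simp add: algebra_simps power2_eq_square)
    thus ?thesis using False u by (simp add: zero_le_mult_iff)
  qed
qed

text \<open>
  The discriminant inequality is applied to the quadratic form \<open>(a, b) \<mapsto> L((a + b f)\<^sup>2)\<close>, whose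
  coefficients are \<open>L(1)\<close>, \<open>L(f)\<close> and \<open>L(f\<^sup>2)\<close>.
\<close>

lemma psd_functional_Cauchy_Schwarz:
  assumes L: "linear_functional L" "psd_functional L"
  shows "(L f)\<^sup>2 \<le> L 1 * L (f\<^sup>2)"
proof (rule nonneg_quadratic_form_imp_discriminant)
  fix a b
  have "(poly_scale a 1 + poly_scale b f)\<^sup>2
      = poly_scale (a\<^sup>2) 1 + poly_scale (2 * a * b) f + poly_scale (b\<^sup>2) (f\<^sup>2)"
    using poly_scale_of_nat[of 2 "poly_scale (a * b) f"]
    by (simp add: power2_eq_square ring_distribs poly_scale_times times_poly_scale
        poly_scale_poly_scale mult_ac mult_2)
  moreover have "0 \<le> L ((poly_scale a 1 + poly_scale b f)\<^sup>2)"
    using L(2) by (simp add: psd_functional_def)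
  ultimately show "0 \<le> a\<^sup>2 * L 1 + 2 * a * b * L f + b\<^sup>2 * L (f\<^sup>2)"
    by (simp add: linear_functionalD[OF L(1)])
qed

lemma le_1_if_iterated_squares_bounded:
  fixes a :: real
  assumes "\<And>k. a ^ (2 ^ k) \<le> C"
  shows "a \<le> 1"
proof (rule ccontr)
  assume a: "\<not> a \<le> 1"
  then obtain k where k: "C < a ^ k" using real_arch_pow[of a C] by auto
  have "a ^ k \<le> a ^ (2 ^ k)"
    using a less_exp[of k] by (intro power_increasing) auto
  with assms[of k] k show False by simp
qed

text \<open>
  The normalised numbers \<open>a\<^sub>k = |L(X\<^sub>i^(2^k))| / L(1)\<close> satisfy \<open>a\<^sub>k\<^sup>2 \<le> a\<^sub>k\<^sub>+\<^sub>1\<close> by Cauchy-Schwarz, so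
  \<open>a\<^sub>0^(2^k) \<le> a\<^sub>k\<close>. The growth condition bounds \<open>a\<^sub>k\<close> by a constant times \<open>r\<^sub>i^(2^k)\<close>, and the
  constant disappears on taking roots.
\<close>

lemma coord_bound:
  fixes r :: "real ^ 'n::finite"
  assumes L: "linear_functional L" "psd_functional L" "growth_bounded r L" and r: "0 < r $ i"
  shows "\<bar>L (coord i)\<bar> \<le> r $ i * L 1"
proof -
  note CS = psd_functional_Cauchy_Schwarz[OF L(1,2)]
  have nonneg: "0 \<le> L 1" using L(2)[unfolded psd_functional_def, rule_format, of 1] by simp
  show ?thesis
  proof (cases "L 1 = 0")
    case True
    thus ?thesis using CS[of "coord i"] by simp
  next
    case False
    with nonneg have pos: "0 < L 1" by simp
    from L(3) obtain C where C: "\<bar>L (monomial \<alpha>)\<bar> \<le> C * weight r \<alpha>" for \<alpha>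
      by (auto simp: growth_bounded_def)
    define a where "a k = \<bar>L (coord i ^ (2 ^ k))\<bar> / L 1" for k
    have step: "a k ^ 2 \<le> a (Suc k)" for k
    proof -
      have "(coord i ^ 2 ^ k)\<^sup>2 = coord i ^ 2 ^ Suc k" by (simp add: mult.commute flip: power_mult)
      with CS[of "coord i ^ (2 ^ k)"]
      have "(L (coord i ^ 2 ^ k))\<^sup>2 \<le> L 1 * \<bar>L (coord i ^ 2 ^ Suc k)\<bar>"
        using mult_left_mono[OF abs_ge_self nonneg] order_trans by metis
      hence "(L (coord i ^ 2 ^ k))\<^sup>2 / (L 1)\<^sup>2 \<le> L 1 * \<bar>L (coord i ^ 2 ^ Suc k)\<bar> / (L 1)\<^sup>2"
        by (rule divide_right_mono) simp
      also have "\<dots> = a (Suc k)" using pos by (simp add: a_def power2_eq_square)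
      finally show ?thesis by (simp add: a_def power_divide)
    qed
    have iter: "a 0 ^ (2 ^ k) \<le> a k" for k
    proof (induction k)
      case (Suc k)
      have "a 0 ^ (2 ^ Suc k) = (a 0 ^ (2 ^ k))\<^sup>2" by (simp add: mult.commute flip: power_mult)
      also have "\<dots> \<le> (a k)\<^sup>2" using Suc pos by (intro power_mono) (simp_all add: a_def)
      finally show ?case using step[of k] by simp
    qed simp
    have "(a 0 / r $ i) ^ (2 ^ k) \<le> C / L 1" for k
    proof -
      have "a 0 ^ (2 ^ k) \<le> C * (r $ i) ^ (2 ^ k) / L 1"
        using iter[of k] C[of "Poly_Mapping.single i (2 ^ k)"] pos
          divide_right_mono[of _ _ "L 1"]
        unfolding a_def coord_power weight_single by (meson less_imp_le order_trans)
      thus ?thesis using r pos by (simp add: power_divide pos_divide_le_eq pos_le_divide_eq mult.commute)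
    qed
    hence "a 0 / r $ i \<le> 1" by (rule le_1_if_iterated_squares_bounded)
    thus ?thesis using r pos by (simp add: a_def divide_simps mult_ac split: if_splits)
  qed
qed

definition bounded_psd :: "real ^ 'n::finite \<Rightarrow> ('n rpoly \<Rightarrow> real) \<Rightarrow> bool" where
  "bounded_psd r L \<longleftrightarrow> linear_functional L \<and> psd_functional L \<and> growth_bounded r L"

text \<open>
  The polynomial \<open>(r\<^sub>i + X\<^sub>i) / (2 r\<^sub>i)\<close>, which maps \<open>[- r\<^sub>i, r\<^sub>i]\<close> affinely onto \<open>[0, 1]\<close>.
\<close>

definition unit_coord :: "real ^ 'n::finite \<Rightarrow> 'n \<Rightarrow> 'n rpoly" where
  "unit_coord r i = poly_scale (1 / 2) 1 + poly_scale (1 / (2 * r $ i)) (coord i)"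

text \<open>
  The bound on the image of \<open>X\<^sub>i\<close> is applied to the functional \<open>f \<mapsto> L(h\<^sup>2 f)\<close>, giving
  \<open>|L(X\<^sub>i h\<^sup>2)| \<le> r\<^sub>i L(h\<^sup>2)\<close>. Because the growth condition is inherited too, the step can be iterated.
\<close>

lemma bounded_psd_unit_coord:
  fixes r :: "real ^ 'n::finite"
  assumes L: "bounded_psd r L" and r: "0 < r $ i"
  shows "bounded_psd r (\<lambda>f. L (unit_coord r i * f))"
    and "bounded_psd r (\<lambda>f. L ((1 - unit_coord r i) * f))"
proof -
  have lin: "linear_functional L" and psd: "psd_functional L" and bd: "growth_bounded r L"
    using L by (auto simp: bounded_psd_def)
  have *: "\<bar>L (coord i * h\<^sup>2)\<bar> \<le> r $ i * L (h\<^sup>2)" for h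
  proof -
    have "psd_functional (\<lambda>f. L (h\<^sup>2 * f))"
      using psd unfolding psd_functional_def by (metis power_mult_distrib)
    from coord_bound[OF linear_functional_shift[OF lin] this growth_bounded_shift[OF lin bd] r]
    show ?thesis by (simp add: mult.commute)
  qed
  have half: "1 - poly_scale (1 / 2) 1 = (poly_scale (1 / 2) 1 :: 'n rpoly)"
    by (rule poly_mapping_eqI)
       (simp add: lookup_minus lookup_poly_scale lookup_one when_def)
  have half_bounds: "0 \<le> 1 / 2 * u + 1 / (2 * r $ i) * v" "0 \<le> 1 / 2 * u - 1 / (2 * r $ i) * v"
    if "\<bar>v\<bar> \<le> r $ i * u" for u v
    using that r by (simp_all add: abs_le_iff field_simps)
  have "0 \<le> L (unit_coord r i * h\<^sup>2)" for h
    using half_bounds(1)[OF *[of h]]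
    by (simp only: unit_coord_def distrib_right poly_scale_times linear_functionalD[OF lin] mult_1_left)
  moreover have "0 \<le> L ((1 - unit_coord r i) * h\<^sup>2)" for h
  proof -
    have "1 - unit_coord r i = poly_scale (1 / 2) 1 - poly_scale (1 / (2 * r $ i)) (coord i)"
      unfolding unit_coord_def by (simp only: half diff_diff_eq[symmetric])
    thus ?thesis
      using half_bounds(2)[OF *[of h]]
      by (simp only: left_diff_distrib poly_scale_times linear_functionalD[OF lin] mult_1_left)
  qed
  ultimately show "bounded_psd r (\<lambda>f. L (unit_coord r i * f))"
    "bounded_psd r (\<lambda>f. L ((1 - unit_coord r i) * f))"
    unfolding bounded_psd_def psd_functional_def
    using linear_functional_shift[OF lin] growth_bounded_shift[OF lin bd] by auto
qed

text \<open>
  Quantifying over all functionals makes the class of these multipliers closed under products,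
  which nonnegativity of a single \<open>L\<close> on given polynomials would not be.
\<close>

definition preserves_psd :: "real ^ 'n::finite \<Rightarrow> 'n rpoly \<Rightarrow> bool" where
  "preserves_psd r p \<longleftrightarrow> (\<forall>L. bounded_psd r L \<longrightarrow> bounded_psd r (\<lambda>f. L (p * f)))"

lemma preserves_psd_1: "preserves_psd r 1"
  by (simp add: preserves_psd_def)

lemma preserves_psd_times:
  assumes "preserves_psd r p" "preserves_psd r q"
  shows "preserves_psd r (p * q)"
  unfolding preserves_psd_def
proof (intro allI impI)
  fix L assume "bounded_psd r L"
  hence "bounded_psd r (\<lambda>f. L (p * (q * f)))"
    using assms unfolding preserves_psd_def by blast
  thus "bounded_psd r (\<lambda>f. L (p * q * f))" by (simp add: mult.assoc)
qed

lemma preserves_psd_power: "preserves_psd r p \<Longrightarrow> preserves_psd r (p ^ k)"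
  by (induction k) (simp_all add: preserves_psd_1 preserves_psd_times)

lemma preserves_psd_prod: "(\<And>i. i \<in> A \<Longrightarrow> preserves_psd r (f i)) \<Longrightarrow> preserves_psd r (prod f A)"
  by (induction A rule: infinite_finite_induct) (simp_all add: preserves_psd_1 preserves_psd_times)

lemma preserves_psd_of_nat: "preserves_psd r (of_nat k)"
  unfolding preserves_psd_def
proof (intro allI impI)
  fix L assume L: "bounded_psd r L"
  hence lin: "linear_functional L" by (simp add: bounded_psd_def)
  have "L (of_nat k * f) = real k * L f" for f
    by (simp add: linear_functionalD[OF lin] flip: poly_scale_of_nat)
  thus "bounded_psd r (\<lambda>f. L (of_nat k * f))"
    using L linear_functional_shift[OF lin, of "of_nat k"] growth_bounded_shift[OF lin, of r "of_nat k"]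
    unfolding bounded_psd_def psd_functional_def by simp
qed

definition bernstein :: "nat \<Rightarrow> nat \<Rightarrow> 'a \<Rightarrow> 'a::comm_ring_1" where
  "bernstein m k t = of_nat (m choose k) * t ^ k * (1 - t) ^ (m - k)"

lemma bernstein_nonneg:
  fixes r :: "real ^ 'n::finite"
  assumes L: "bounded_psd r L" and r: "\<And>i. 0 < r $ i"
  shows "0 \<le> L (\<Prod>i\<in>UNIV. bernstein m (k i) (unit_coord r i))"
proof -
  have "preserves_psd r (unit_coord r i)" "preserves_psd r (1 - unit_coord r i)" for i
    using bounded_psd_unit_coord r unfolding preserves_psd_def by blast+
  hence "preserves_psd r (\<Prod>i\<in>UNIV. bernstein m (k i) (unit_coord r i))"
    unfolding bernstein_def
    by (intro preserves_psd_prod preserves_psd_times preserves_psd_power preserves_psd_of_nat)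
  with L have "psd_functional (\<lambda>f. L ((\<Prod>i\<in>UNIV. bernstein m (k i) (unit_coord r i)) * f))"
    by (auto simp: preserves_psd_def bounded_psd_def)
  from this[unfolded psd_functional_def, rule_format, of 1] show ?thesis by simp
qed

section \<open>Convergence of Bernstein moments\<close>

text \<open>
  Since \<open>(m choose k) (k choose a) = (m choose a) (m - a choose k - a)\<close>, the sum reduces to the
  binomial expansion of \<open>(t + (1 - t))\<^sup>m\<^sup>-\<^sup>a\<close>. Binomial moments are used because they are exact,
  unlike the power moments of the Bernstein basis.
\<close>

lemma bernstein_binomial_moment:
  fixes t :: "'a::comm_ring_1"
  shows "(\<Sum>k\<le>m. of_nat (k choose a) * bernstein m k t) = of_nat (m choose a) * t ^ a"
proof (cases "a \<le> m")
  case True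
  have "(\<Sum>k\<le>m. of_nat (k choose a) * bernstein m k t)
      = (\<Sum>k\<in>{a..m}. of_nat (k choose a) * bernstein m k t)"
    by (rule sum.mono_neutral_right) (auto simp: binomial_eq_0)
  also have "\<dots> = (\<Sum>k\<in>{a..m}. of_nat (m choose a) * t ^ a *
      (of_nat ((m - a) choose (k - a)) * t ^ (k - a) * (1 - t) ^ (m - a - (k - a))))"
  proof (rule sum.cong)
    fix k assume k: "k \<in> {a..m}"
    have "of_nat (k choose a) * bernstein m k t
        = (of_nat ((m choose k) * (k choose a)) * t ^ k * (1 - t) ^ (m - k) :: 'a)"
      by (simp add: bernstein_def mult_ac)
    also have "t ^ k = t ^ a * t ^ (k - a)" using k by (simp flip: power_add)
    also have "(m choose k) * (k choose a) = (m choose a) * ((m - a) choose (k - a))"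
      using k by (intro choose_mult) auto
    also have "m - k = m - a - (k - a)" using k by simp
    finally show "of_nat (k choose a) * bernstein m k t = of_nat (m choose a) * t ^ a *
      (of_nat ((m - a) choose (k - a)) * t ^ (k - a) * (1 - t) ^ (m - a - (k - a)))"
      by (simp add: mult_ac)
  qed simp
  also have "\<dots> = of_nat (m choose a) * t ^ a *
      (\<Sum>k\<le>m - a. of_nat ((m - a) choose k) * t ^ k * (1 - t) ^ (m - a - k))"
    unfolding sum_distrib_left
    by (rule sum.reindex_bij_witness[of _ "\<lambda>k. k + a" "\<lambda>k. k - a"]) (use True in auto)
  also have "(\<Sum>k\<le>m - a. of_nat ((m - a) choose k) * t ^ k * (1 - t) ^ (m - a - k)) = (t + (1 - t)) ^ (m - a)"
    by (rule binomial_ring[symmetric])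
  finally show ?thesis by simp
next
  case False
  thus ?thesis by (simp add: binomial_eq_0)
qed

text \<open>
  Tensor product of the one-variable identities. For \<open>a = 0\<close> it says that the weights
  add up to \<open>L(1)\<close>.
\<close>

lemma bernstein_functional_moment:
  fixes r :: "real ^ 'n::finite"
  assumes lin: "linear_functional L" and m: "\<And>i. a i \<le> m"
  shows "(\<Sum>k\<in>PiE UNIV (\<lambda>_. {..m}). L (\<Prod>i\<in>UNIV. bernstein m (k i) (unit_coord r i)) *
            (\<Prod>i\<in>UNIV. real (k i choose a i) / real (m choose a i)))
       = L (\<Prod>i\<in>UNIV. unit_coord r i ^ a i)"
proof -
  let ?c = "\<Prod>i\<in>UNIV. real (m choose a i)"
  have pull: "L (of_nat k * f) = real k * L f" for k f
    by (simp add: linear_functionalD[OF lin] flip: poly_scale_of_nat)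
  have "?c * L (\<Prod>i\<in>UNIV. unit_coord r i ^ a i)
      = L (\<Prod>i\<in>UNIV. of_nat (m choose a i) * unit_coord r i ^ a i)"
    using pull[of "\<Prod>i\<in>UNIV. m choose a i"] by (simp add: prod.distrib)
  also have "\<dots> = L (\<Sum>k\<in>PiE UNIV (\<lambda>_. {..m}). \<Prod>i\<in>UNIV. of_nat (k i choose a i) * bernstein m (k i) (unit_coord r i))"
    by (simp add: prod_sum_PiE flip: bernstein_binomial_moment)
  also have "\<dots> = (\<Sum>k\<in>PiE UNIV (\<lambda>_. {..m}). L (\<Prod>i\<in>UNIV. bernstein m (k i) (unit_coord r i)) *
            (\<Prod>i\<in>UNIV. real (k i choose a i)))"
    unfolding linear_functionalD[OF lin]
  proof (rule sum.cong)
    fix k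
    show "L (\<Prod>i\<in>UNIV. of_nat (k i choose a i) * bernstein m (k i) (unit_coord r i)) =
      L (\<Prod>i\<in>UNIV. bernstein m (k i) (unit_coord r i)) * (\<Prod>i\<in>UNIV. real (k i choose a i))"
      using pull[of "\<Prod>i\<in>UNIV. k i choose a i" "\<Prod>i\<in>UNIV. bernstein m (k i) (unit_coord r i)"]
      by (simp add: prod.distrib mult.commute)
  qed simp
  finally have *: "?c * L (\<Prod>i\<in>UNIV. unit_coord r i ^ a i) = \<dots>" .
  have "?c \<noteq> 0" using m by (simp add: not_less)
  from nonzero_mult_div_cancel_left[OF this, of "L (\<Prod>i\<in>UNIV. unit_coord r i ^ a i)"] show ?thesis
    by (simp only: * prod_dividef times_divide_eq_right sum_divide_distrib)
qed

text \<open>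
  Both numbers are products of \<open>a\<close> factors in \<open>[-1, 1]\<close>, namely \<open>(k - j) / (m - j)\<close> and \<open>k / m\<close>
  for \<open>j < a\<close>, and corresponding factors differ by \<open>(j / (m - j)) ((m - k) / m)\<close>. For \<open>k < j\<close> the
  first factor is negative, and \<open>2 a < m\<close> keeps it above \<open>-1\<close>. The bound is
  uniform in \<open>k\<close>, as it has to survive a summation over the grid.
\<close>

lemma binomial_ratio_approx:
  assumes "2 * a < m" "k \<le> m"
  shows "\<bar>real (k choose a) / real (m choose a) - (real k / real m) ^ a\<bar> \<le> real a * (real a / (real m - real a))"
proof -
  have "real (k choose a) / real (m choose a) = (\<Prod>j\<in>{0..<a}. (real k - real j) / (real m - real j))"
    by (simp add: binomial_gbinomial gbinomial_prod_rev prod_dividef)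
  moreover have "(real k / real m) ^ a = (\<Prod>j\<in>{0..<a}. real k / real m)" by simp
  moreover have "norm ((\<Prod>j\<in>{0..<a}. (real k - real j) / (real m - real j)) - (\<Prod>j\<in>{0..<a}. real k / real m))
      \<le> (\<Sum>j\<in>{0..<a}. norm ((real k - real j) / (real m - real j) - real k / real m))"
    by (rule norm_prod_diff) (use assms in \<open>auto simp: divide_simps abs_le_iff\<close>)
  moreover have "norm ((real k - real j) / (real m - real j) - real k / real m) \<le> real a / (real m - real a)"
    if "j \<in> {0..<a}" for j
  proof -
    have pos: "0 < real m" "0 < real m - real j" "0 < real m - real a" using assms that by auto
    have "(real k - real j) / (real m - real j) - real k / real m
        = - ((real j / (real m - real j)) * ((real m - real k) / real m))"
      using pos by (simp add: field_simps)
    also have "norm \<dots> = (real j / (real m - real j)) * ((real m - real k) / real m)"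
      using pos assms by (simp add: abs_mult)
    also have "\<dots> \<le> (real a / (real m - real a)) * 1"
      using pos assms that by (intro mult_mono frac_le) auto
    finally show ?thesis by simp
  qed
  ultimately show ?thesis
    using sum_bounded_above[of "{0..<a}" "\<lambda>j. norm ((real k - real j) / (real m - real j) - real k / real m)"
        "real a / (real m - real a)"]
    by simp
qed

text \<open>
  Replacing the ratios of binomial coefficients in the exact formula by powers of the grid
  coordinates changes the sum by at most the total weight \<open>L(1)\<close> times an error of order \<open>1/m\<close>.
\<close>

lemma bernstein_grid_moment_tendsto:
  fixes r :: "real ^ 'n::finite"
  assumes L: "bounded_psd r L" and r: "\<And>i. 0 < r $ i"
  shows "(\<lambda>m. \<Sum>k\<in>PiE UNIV (\<lambda>_. {..m}). L (\<Prod>i\<in>UNIV. bernstein m (k i) (unit_coord r i)) *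
            (\<Prod>i\<in>UNIV. (real (k i) / real m) ^ a i))
         \<longlonglongrightarrow> L (\<Prod>i\<in>UNIV. unit_coord r i ^ a i)"
proof -
  have lin: "linear_functional L" using L by (simp add: bounded_psd_def)
  define w where "w m k = L (\<Prod>i\<in>UNIV. bernstein m (k i) (unit_coord r i))" for m and k :: "'n \<Rightarrow> nat"
  have w: "0 \<le> w m k" for m k unfolding w_def by (rule bernstein_nonneg[OF L r])
  have total: "(\<Sum>k\<in>PiE UNIV (\<lambda>_. {..m}). w m k) = L 1" for m
    using bernstein_functional_moment[OF lin, of "\<lambda>_. 0" m r] by (simp add: w_def)
  define err where "err m = (\<Sum>i\<in>UNIV. real (a i) * (real (a i) / (real m - real (a i))))" for m
  have bound: "norm ((\<Sum>k\<in>PiE UNIV (\<lambda>_. {..m}). w m k * (\<Prod>i\<in>UNIV. (real (k i) / real m) ^ a i))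
      - L (\<Prod>i\<in>UNIV. unit_coord r i ^ a i)) \<le> L 1 * err m"
    if m: "2 * (\<Sum>i\<in>UNIV. a i) < m" for m
  proof -
    have am: "2 * a i < m" for i
      using member_le_sum[of i UNIV a] m by simp
    have each: "\<bar>(\<Prod>i\<in>UNIV. real (k i choose a i) / real (m choose a i))
        - (\<Prod>i\<in>UNIV. (real (k i) / real m) ^ a i)\<bar> \<le> err m"
      if k: "k \<in> PiE UNIV (\<lambda>_. {..m})" for k
    proof -
      have km: "k i \<le> m" for i using k by auto
      have "norm ((\<Prod>i\<in>UNIV. real (k i choose a i) / real (m choose a i))
        - (\<Prod>i\<in>UNIV. (real (k i) / real m) ^ a i))
        \<le> (\<Sum>i\<in>UNIV. norm (real (k i choose a i) / real (m choose a i) - (real (k i) / real m) ^ a i))"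
      proof (rule norm_prod_diff)
        fix i
        show "norm (real (k i choose a i) / real (m choose a i)) \<le> 1"
          using binomial_right_mono[OF km[of i], of "a i"] am[of i] by (simp add: divide_le_eq_1)
        show "norm ((real (k i) / real m) ^ a i) \<le> 1"
          using km[of i] by (auto intro!: power_le_one simp: divide_le_eq_1)
      qed
      also have "\<dots> \<le> err m"
        unfolding err_def real_norm_def by (intro sum_mono binomial_ratio_approx am km)
      finally show ?thesis by simp
    qed
    have "(\<Sum>k\<in>PiE UNIV (\<lambda>_. {..m}). w m k * (\<Prod>i\<in>UNIV. (real (k i) / real m) ^ a i))
      - L (\<Prod>i\<in>UNIV. unit_coord r i ^ a i)
      = (\<Sum>k\<in>PiE UNIV (\<lambda>_. {..m}). w m k * ((\<Prod>i\<in>UNIV. (real (k i) / real m) ^ a i)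
          - (\<Prod>i\<in>UNIV. real (k i choose a i) / real (m choose a i))))"
    proof -
      have "a i \<le> m" for i using am[of i] by simp
      from bernstein_functional_moment[OF lin this, where r = r, symmetric] show ?thesis
        by (simp only: w_def right_diff_distrib sum_subtractf)
    qed
    also have "norm \<dots> \<le> (\<Sum>k\<in>PiE UNIV (\<lambda>_. {..m}). w m k * err m)"
      using each by (intro sum_norm_le) (simp add: abs_mult w mult_left_mono abs_minus_commute)
    also have "\<dots> = L 1 * err m" by (simp only: total flip: sum_distrib_right)
    finally show ?thesis .
  qed
  have "(\<lambda>m. real (a i) * (real (a i) / (real m - real (a i)))) \<longlonglongrightarrow> 0" for i
    by real_asymp
  hence "err \<longlonglongrightarrow> 0" unfolding err_def by (intro tendsto_null_sum)
  hence "(\<lambda>m. L 1 * err m) \<longlonglongrightarrow> 0" by (intro tendsto_mult_right_zero)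
  moreover have "\<forall>\<^sub>F m in sequentially. norm ((\<Sum>k\<in>PiE UNIV (\<lambda>_. {..m}). w m k * (\<Prod>i\<in>UNIV. (real (k i) / real m) ^ a i))
      - L (\<Prod>i\<in>UNIV. unit_coord r i ^ a i)) \<le> L 1 * err m"
    using eventually_gt_at_top[of "2 * (\<Sum>i\<in>UNIV. a i)"] by eventually_elim (rule bound)
  ultimately show ?thesis
    unfolding w_def[symmetric] by (subst LIM_zero_iff[symmetric]) (rule Lim_null_comparison)
qed

section \<open>Weak limits through a space-filling curve\<close>

text \<open>
  A continuous function of period 2 that is \<open>0\<close> on \<open>[0, 1/3]\<close> and \<open>1\<close> on \<open>[2/3, 1]\<close>. The cosine
  supplies periodicity, and truncation supplies the two plateaus, since \<open>cos(\<pi>/3) = 1/2\<close>.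
\<close>

definition plateau :: "real \<Rightarrow> real" where
  "plateau t = max 0 (min 1 (1 / 2 - cos (pi * t)))"

lemma plateau_range: "0 \<le> plateau t" "plateau t \<le> 1"
  by (auto simp: plateau_def)

lemma continuous_on_plateau [continuous_intros]:
  fixes f :: "'a::t2_space \<Rightarrow> real"
  assumes "continuous_on A f"
  shows "continuous_on A (\<lambda>x. plateau (f x))"
  unfolding plateau_def by (intro continuous_intros assms)

lemma plateau_periodic: "plateau (2 * real n + t) = plateau t"
proof -
  have "pi * (2 * real n + t) = 2 * real n * pi + pi * t" by (simp add: algebra_simps)
  hence "cos (pi * (2 * real n + t)) = cos (pi * t)"
    by (simp only: cos_add cos_2npi sin_2npi mult_1_left mult_zero_left diff_0_right)
  thus ?thesis by (simp add: plateau_def)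
qed

lemma plateau_low: assumes "0 \<le> t" "t \<le> 1 / 3" shows "plateau t = 0"
proof -
  have "cos (pi / 3) \<le> cos (pi * t)"
    using assms mult_left_mono[of t "1 / 3" pi] by (intro cos_monotone_0_pi_le) auto
  thus ?thesis by (simp add: plateau_def cos_60)
qed

lemma plateau_high: assumes "2 / 3 \<le> t" "t \<le> 1" shows "plateau t = 1"
proof -
  have "plateau t = max 0 (min 1 (1 / 2 + cos (pi * (1 - t))))"
    by (simp add: plateau_def right_diff_distrib cos_diff)
  moreover have "cos (pi / 3) \<le> cos (pi * (1 - t))"
    using assms mult_left_mono[of "1 - t" "1 / 3" pi] mult_left_mono[of "1 - t" 1 pi]
    by (intro cos_monotone_0_pi_le) auto
  ultimately show ?thesis by (simp add: cos_60)
qed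

text \<open>
  The point of the Cantor set whose ternary digits are \<open>2 c\<^sub>0, 2 c\<^sub>1, \<dots>\<close>.
\<close>

definition cantor_point :: "(nat \<Rightarrow> nat) \<Rightarrow> real" where
  "cantor_point c = suminf (\<lambda>j. 2 * real (c j) / 3 ^ Suc j)"

lemma cantor_point_summable:
  assumes "\<And>j. c j \<le> 1" shows "summable (\<lambda>j. 2 * real (c j) / 3 ^ Suc j)"
proof (rule summable_comparison_test')
  show "summable (\<lambda>j. 2 / 3 * (1 / 3 :: real) ^ j)"
    by (intro summable_mult summable_geometric) simp
  show "norm (2 * real (c j) / 3 ^ Suc j) \<le> 2 / 3 * (1 / 3) ^ j" for j
    using assms[of j] by (simp add: power_divide divide_simps)
qed

lemma cantor_point_range:
  assumes c: "\<And>j. c j \<le> 1" shows "0 \<le> cantor_point c" "cantor_point c \<le> 1"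
proof -
  show "0 \<le> cantor_point c"
    unfolding cantor_point_def by (intro suminf_nonneg cantor_point_summable c) simp
  have "cantor_point c \<le> suminf (\<lambda>j. 2 / 3 * (1 / 3) ^ j)"
    unfolding cantor_point_def
  proof (rule suminf_le)
    show "2 * real (c j) / 3 ^ Suc j \<le> 2 / 3 * (1 / 3) ^ j" for j
      using c[of j] by (simp add: power_divide divide_simps)
  qed (rule cantor_point_summable[OF c], intro summable_mult summable_geometric, simp)
  also have "\<dots> = 1"
    by (subst suminf_mult) (simp_all add: suminf_geometric)
  finally show "cantor_point c \<le> 1" .
qed

lemma cantor_point_shift:
  assumes c: "\<And>j. c j \<le> 1"
  shows "3 * cantor_point c = 2 * real (c 0) + cantor_point (\<lambda>j. c (Suc j))"
proof -
  have "cantor_point c = 2 * real (c 0) / 3 + suminf (\<lambda>j. 2 * real (c (Suc j)) / 3 ^ Suc (Suc j))"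
    unfolding cantor_point_def using suminf_split_head[OF cantor_point_summable[of c]] c by simp
  also have "suminf (\<lambda>j. 2 * real (c (Suc j)) / 3 ^ Suc (Suc j)) = suminf (\<lambda>j. 1 / 3 * (2 * real (c (Suc j)) / 3 ^ Suc j))"
    by simp
  also have "\<dots> = 1 / 3 * cantor_point (\<lambda>j. c (Suc j))"
    unfolding cantor_point_def by (intro suminf_mult cantor_point_summable c)
  finally show ?thesis by simp
qed

text \<open>
  Multiplication by \<open>3\<^sup>m\<close> moves the first \<open>m\<close> ternary digits in front of the point, where they form
  an even integer, invisible to a function of period 2. The next digit, \<open>0\<close> or \<open>2\<close>, decides which
  plateau the fractional part lies on.
\<close>

lemma plateau_cantor_point:
  assumes "\<And>j. c j \<le> 1"
  shows "plateau (3 ^ m * cantor_point c) = real (c m)"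
  using assms
proof (induction m arbitrary: c)
  case 0
  let ?u = "cantor_point (\<lambda>j. c (Suc j))"
  have u: "0 \<le> ?u" "?u \<le> 1" using cantor_point_range[of "\<lambda>j. c (Suc j)"] 0 by auto
  note s = cantor_point_shift[of c, OF 0]
  from 0[of 0] consider "c 0 = 0" | "c 0 = 1" by linarith
  thus ?case
  proof cases
    case 1
    thus ?thesis using s u by (simp add: plateau_low)
  next
    case 2
    thus ?thesis using s u by (simp add: plateau_high)
  qed
next
  case (Suc m)
  have "3 ^ Suc m * cantor_point c = 2 * real (3 ^ m * c 0) + 3 ^ m * cantor_point (\<lambda>j. c (Suc j))"
    using arg_cong[OF cantor_point_shift[of c, OF Suc.prems], of "\<lambda>x. 3 ^ m * x"]
    by (simp add: algebra_simps)
  thus ?case using Suc.IH[of "\<lambda>j. c (Suc j)"] Suc.prems by (simp only: plateau_periodic) 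
qed

text \<open>
  Greedy algorithm: \<open>z n\<close> is the remainder after \<open>n\<close> digits, rescaled by \<open>2\<^sup>n\<close> so as to stay in \<open>[0, 1]\<close>.
\<close>

lemma binary_expansion:
  fixes y :: real
  assumes "0 \<le> y" "y \<le> 1"
  obtains b :: "nat \<Rightarrow> nat" where "\<And>k. b k \<le> 1" "(\<lambda>k. real (b k) / 2 ^ Suc k) sums y"
proof -
  define bit :: "real \<Rightarrow> nat" where "bit z = (if z \<ge> 1 / 2 then 1 else 0)" for z
  define z where "z = rec_nat y (\<lambda>_ z. 2 * z - real (bit z))"
  have z0: "z 0 = y" and zS: "z (Suc n) = 2 * z n - real (bit (z n))" for n
    by (simp_all add: z_def)
  have z: "0 \<le> z n \<and> z n \<le> 1" for n
    by (induction n) (use assms in \<open>auto simp: z0 zS bit_def\<close>)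
  have partial: "(\<Sum>k<n. real (bit (z k)) / 2 ^ Suc k) = y - z n / 2 ^ n" for n
    by (induction n) (simp_all add: z0 zS field_simps)
  have "(\<lambda>n. z n / 2 ^ n) \<longlonglongrightarrow> 0"
  proof (rule Lim_null_comparison)
    show "\<forall>\<^sub>F n in sequentially. norm (z n / 2 ^ n) \<le> (1 / 2) ^ n"
      using z by (auto simp: power_divide divide_simps)
    show "(\<lambda>n. (1 / 2 :: real) ^ n) \<longlonglongrightarrow> 0" by (rule LIMSEQ_realpow_zero) auto
  qed
  hence "(\<lambda>n. y - z n / 2 ^ n) \<longlonglongrightarrow> y - 0" by (intro tendsto_intros)
  hence "(\<lambda>k. real (bit (z k)) / 2 ^ Suc k) sums y" by (simp only: sums_def partial diff_0_right)
  thus ?thesis by (intro that[of "\<lambda>k. bit (z k)"]) (auto simp: bit_def)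
qed

abbreviation unit_cube :: "(real ^ 'n) set" where
  "unit_cube \<equiv> {y. \<forall>i. y $ i \<in> {0..1}}"

lemma compact_unit_cube: "compact (unit_cube :: (real ^ 'n::finite) set)"
proof -
  have "unit_cube = (cbox 0 1 :: (real ^ 'n) set)" by (auto simp: mem_box_cart)
  thus ?thesis by simp
qed

text \<open>
  The binary digits of all coordinates of a point of the cube are interleaved into one sequence,
  the \<open>k\<close>-th digit of coordinate \<open>i\<close> at position \<open>pos i k\<close>. The curve reads them off from the point
  of the Cantor set with that digit sequence. Unlike the digits themselves, the
  function that reads them is continuous on the whole line.
\<close>

theorem Schoenberg_space_filling_curve:
  obtains \<phi> :: "real \<Rightarrow> real ^ 'n::finite"
  where "continuous_on UNIV \<phi>" "range \<phi> \<subseteq> unit_cube" "unit_cube \<subseteq> \<phi> ` {0..1}"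
proof -
  let ?N = "CARD('n)"
  obtain idx :: "'n \<Rightarrow> nat" where idx: "bij_betw idx UNIV {0..<?N}"
    using ex_bij_betw_finite_nat[of "UNIV :: 'n set"] by auto
  define pos where "pos i k = ?N * k + idx i" for i k
  have idx_less: "idx i < ?N" for i using idx by (auto simp: bij_betw_def)
  have pos_div: "pos i k div ?N = k" for i k by (simp add: pos_def idx_less)
  have pos_mod: "inv_into UNIV idx (pos i k mod ?N) = i" for i k
    using idx by (simp add: pos_def idx_less bij_betw_def inv_into_f_f)
  define summand where "summand i k t = plateau (3 ^ pos i k * t) / 2 ^ Suc k" for i k t
  define \<phi> :: "real \<Rightarrow> real ^ 'n" where "\<phi> t = (\<chi> i. suminf (\<lambda>k. summand i k t))" for t
  have geo: "(\<lambda>k. 1 / 2 * (1 / 2 :: real) ^ k) sums 1"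
    using sums_mult[OF geometric_sums[of "1 / 2 :: real"], of "1 / 2"] by simp
  have summand: "0 \<le> summand i k t" "summand i k t \<le> 1 / 2 * (1 / 2) ^ k" for i k t
    using plateau_range[of "3 ^ pos i k * t"] by (auto simp: summand_def power_divide divide_simps)
  have summable: "summable (\<lambda>k. summand i k t)" for i t
    by (rule summable_comparison_test'[OF sums_summable[OF geo]]) (use summand in auto)
  show ?thesis
  proof (rule that)
    show "continuous_on UNIV \<phi>"
      unfolding \<phi>_def
    proof (rule continuous_on_vec_lambda)
      fix i
      have "uniform_limit UNIV (\<lambda>n t. \<Sum>k<n. summand i k t) (\<lambda>t. suminf (\<lambda>k. summand i k t)) sequentially"
        by (rule Weierstrass_m_test[OF _ sums_summable[OF geo]]) (use summand in auto)
      thus "continuous_on UNIV (\<lambda>t. suminf (\<lambda>k. summand i k t))"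
        by (rule uniform_limit_theorem[rotated])
           (auto simp: summand_def intro!: always_eventually continuous_intros)
    qed
    show "range \<phi> \<subseteq> unit_cube"
    proof safe
      fix t i
      have "suminf (\<lambda>k. summand i k t) \<le> suminf (\<lambda>k. 1 / 2 * (1 / 2) ^ k)"
        by (intro suminf_le summand summable sums_summable[OF geo])
      thus "\<phi> t $ i \<in> {0..1}"
        using suminf_nonneg[OF summable summand(1)] sums_unique[OF geo] by (simp add: \<phi>_def)
    qed
    show "unit_cube \<subseteq> \<phi> ` {0..1}"
    proof
      fix y :: "real ^ 'n" assume y: "y \<in> unit_cube"
      have "\<exists>b :: nat \<Rightarrow> nat. (\<forall>k. b k \<le> 1) \<and> (\<lambda>k. real (b k) / 2 ^ Suc k) sums (y $ i)" for i
      proof -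
        have "0 \<le> y $ i" "y $ i \<le> 1" using y by auto
        thus ?thesis by (rule binary_expansion) blast
      qed
      then obtain b where b: "\<And>i k. b i k \<le> (1 :: nat)"
          "\<And>i. (\<lambda>k. real (b i k) / 2 ^ Suc k) sums (y $ i)"
        using choice[of "\<lambda>i b. (\<forall>k. b k \<le> 1) \<and> (\<lambda>k. real (b k) / 2 ^ Suc k) sums (y $ i)"]
        by blast
      \<comment> \<open>Quotient and remainder of \<open>pos i k\<close> by \<open>CARD('n)\<close> recover the digit number and the coordinate.\<close>
      define c where "c m = b (inv_into UNIV idx (m mod ?N)) (m div ?N)" for m
      have c: "c m \<le> 1" for m unfolding c_def by (rule b(1))
      have "summand i k (cantor_point c) = real (b i k) / 2 ^ Suc k" for i k
        unfolding summand_def plateau_cantor_point[of c, OF c]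
        by (simp only: c_def pos_div pos_mod)
      hence "\<phi> (cantor_point c) = y"
        using b(2) by (simp add: \<phi>_def vec_eq_iff sums_unique[symmetric])
      thus "y \<in> \<phi> ` {0..1}" using cantor_point_range[of c, OF c] by auto
    qed
  qed
qed

text \<open>
  Prokhorov's theorem for finitely supported measures on the cube, with the limit presented as the
  law of \<open>\<phi>\<close> under a measure on the line. Finite support makes the lift along \<open>\<phi>\<close> immediate: choose
  one preimage of each point. The lifted measures live on \<open>[0, 1]\<close> and are therefore tight.
\<close>

lemma convergent_subsequence_of_point_measures:
  fixes A :: "nat \<Rightarrow> 'a set" and w :: "nat \<Rightarrow> 'a \<Rightarrow> real" and g :: "nat \<Rightarrow> 'a \<Rightarrow> real ^ 'n::finite"
  assumes fin: "\<And>m. finite (A m)" and nonneg: "\<And>m k. k \<in> A m \<Longrightarrow> 0 \<le> w m k"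
    and total: "\<And>m. (\<Sum>k\<in>A m. w m k) = 1"
    and cube: "\<And>m k. k \<in> A m \<Longrightarrow> g m k \<in> unit_cube"
  obtains \<rho> :: "nat \<Rightarrow> nat" and M :: "real measure" and \<phi> :: "real \<Rightarrow> real ^ 'n"
  where "strict_mono \<rho>" "real_distribution M" "continuous_on UNIV \<phi>" "range \<phi> \<subseteq> unit_cube"
    "\<And>F :: real ^ 'n \<Rightarrow> real. continuous_on unit_cube F \<Longrightarrow>
      (\<lambda>j. \<Sum>k\<in>A (\<rho> j). w (\<rho> j) k * F (g (\<rho> j) k)) \<longlonglongrightarrow> (\<integral>t. F (\<phi> t) \<partial>M)"
proof -
  obtain \<phi> :: "real \<Rightarrow> real ^ 'n"
    where \<phi>: "continuous_on UNIV \<phi>" "range \<phi> \<subseteq> unit_cube" "unit_cube \<subseteq> \<phi> ` {0..1}"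
    by (rule Schoenberg_space_filling_curve)
  define \<tau> where "\<tau> = inv_into {0..1} \<phi>"
  have \<tau>: "0 \<le> \<tau> y \<and> \<tau> y \<le> 1 \<and> \<phi> (\<tau> y) = y" if "y \<in> unit_cube" for y
    using subsetD[OF \<phi>(3) that] inv_into_into[of y \<phi> "{0..1}"] f_inv_into_f[of y \<phi> "{0..1}"]
    unfolding \<tau>_def by (simp only: atLeastAtMost_iff)
  define P where "P m = point_measure (A m) (\<lambda>k. ennreal (w m k))" for m
  define \<nu> where "\<nu> m = distr (P m) borel (\<lambda>k. \<tau> (g m k))" for m
  have space_P: "space (P m) = A m" for m by (simp add: P_def space_point_measure)
  have meas: "f \<in> measurable (P m) borel" for m and f :: "'a \<Rightarrow> real"
    by (auto simp: P_def measurable_point_measure_eq1)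
  have prob_P: "prob_space (P m)" for m
  proof (rule prob_spaceI)
    have "emeasure (P m) (space (P m)) = (\<Sum>k\<in>A m. ennreal (w m k))"
      unfolding space_P unfolding P_def by (rule emeasure_point_measure_finite[OF fin order_refl])
    also have "\<dots> = 1" using sum_ennreal[of "A m" "w m"] nonneg total by simp
    finally show "emeasure (P m) (space (P m)) = 1" .
  qed
  have dist: "real_distribution (\<nu> m)" for m
    unfolding \<nu>_def by (intro prob_space.real_distribution_distr prob_P meas)
  have integral_\<nu>: "(\<integral>t. f t \<partial>\<nu> m) = (\<Sum>k\<in>A m. w m k * f (\<tau> (g m k)))"
    if "f \<in> borel_measurable borel" for f :: "real \<Rightarrow> real" and m
    unfolding \<nu>_def integral_distr[OF meas that]
    unfolding P_def
    using lebesgue_integral_point_measure_finite[of "A m" "w m" "\<lambda>k. f (\<tau> (g m k))"] fin nonneg by simp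
  have "tight \<nu>"
    unfolding tight_def
  proof (intro conjI allI impI)
    fix \<epsilon> :: real assume "0 < \<epsilon>"
    \<comment> \<open>Tightness is about half-open intervals, and \<open>0\<close> may carry mass.\<close>
    have "measure (\<nu> m) {-1<..1} = 1" for m
    proof -
      have "(\<lambda>k. \<tau> (g m k)) -` {-1<..1} \<inter> space (P m) = space (P m)"
        using \<tau>[OF cube[of _ m]] by (force simp: space_P)
      thus ?thesis
        unfolding \<nu>_def using prob_space.prob_space[OF prob_P[of m]]
        by (subst measure_distr[OF meas]) auto
    qed
    thus "\<exists>a b. a < b \<and> (\<forall>m. 1 - \<epsilon> < measure (\<nu> m) {a<..b})"
      using \<open>0 < \<epsilon>\<close> by (intro exI[of _ "-1"] exI[of _ 1]) auto
  qed (rule dist)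
  from tight_imp_convergent_subsubsequence[OF this strict_mono_id]
  obtain \<rho> M where \<rho>: "strict_mono \<rho>" and M: "real_distribution M" and conv: "weak_conv_m (\<nu> \<circ> id \<circ> \<rho>) M"
    by blast
  show ?thesis
  proof (rule that[OF \<rho> M \<phi>(1,2)])
    fix F :: "real ^ 'n \<Rightarrow> real" assume F: "continuous_on unit_cube F"
    have F\<phi>: "continuous_on UNIV (\<lambda>t. F (\<phi> t))"
      by (rule continuous_on_compose2[OF F \<phi>(1,2)])
    from compact_imp_bounded[OF compact_continuous_image[OF F compact_unit_cube]]
    obtain K where K: "\<And>y. y \<in> unit_cube \<Longrightarrow> norm (F y) \<le> K"
      by (auto simp: bounded_iff)
    have "(\<lambda>j. \<integral>t. F (\<phi> t) \<partial>((\<nu> \<circ> id \<circ> \<rho>) j)) \<longlonglongrightarrow> (\<integral>t. F (\<phi> t) \<partial>M)"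
    proof (rule weak_conv_imp_integral_bdd_continuous_conv[OF _ M conv])
      show "real_distribution ((\<nu> \<circ> id \<circ> \<rho>) j)" for j by (simp add: dist)
      show "isCont (\<lambda>t. F (\<phi> t)) t" for t
        using F\<phi> by (simp add: continuous_on_eq_continuous_at)
      show "norm (F (\<phi> t)) \<le> K" for t using \<phi>(2) by (intro K) auto
    qed
    moreover have "(\<integral>t. F (\<phi> t) \<partial>\<nu> m) = (\<Sum>k\<in>A m. w m k * F (g m k))" for m
    proof -
      have "(\<integral>t. F (\<phi> t) \<partial>\<nu> m) = (\<Sum>k\<in>A m. w m k * F (\<phi> (\<tau> (g m k))))"
        by (intro integral_\<nu> borel_measurable_continuous_onI F\<phi>)
      also have "\<dots> = (\<Sum>k\<in>A m. w m k * F (g m k))"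
        by (intro sum.cong) (use \<tau> cube in auto)
      finally show ?thesis .
    qed
    ultimately show "(\<lambda>j. \<Sum>k\<in>A (\<rho> j). w (\<rho> j) k * F (g (\<rho> j) k)) \<longlonglongrightarrow> (\<integral>t. F (\<phi> t) \<partial>M)"
      by simp
  qed
qed

section \<open>The representing measure\<close>

text \<open>
  If \<open>L(1) = 0\<close>, then \<open>L = 0\<close> by Cauchy-Schwarz and any \<open>M\<close> and \<open>\<phi>\<close> will do. Otherwise the Bernstein
  weights divided by \<open>L(1)\<close> are probability measures, and a weak limit of them exists.
\<close>

lemma unit_coord_moments_representation:
  fixes r :: "real ^ 'n::finite"
  assumes L: "bounded_psd r L" and r: "\<And>i. 0 < r $ i"
  obtains M :: "real measure" and \<phi> :: "real \<Rightarrow> real ^ 'n"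
  where "real_distribution M" "continuous_on UNIV \<phi>" "range \<phi> \<subseteq> unit_cube"
    "\<And>a. L (\<Prod>i\<in>UNIV. unit_coord r i ^ a i) = L 1 * (\<integral>t. (\<Prod>i\<in>UNIV. (\<phi> t $ i) ^ a i) \<partial>M)"
proof -
  have lin: "linear_functional L" and psd: "psd_functional L" using L by (auto simp: bounded_psd_def)
  have nonneg: "0 \<le> L 1" using psd[unfolded psd_functional_def, rule_format, of 1] by simp
  show ?thesis
  proof (cases "L 1 = 0")
    case True
    hence "L f = 0" for f using psd_functional_Cauchy_Schwarz[OF lin psd, of f] by simp
    moreover have "real_distribution (return borel (0 :: real))"
      by (auto simp: real_distribution_def real_distribution_axioms_def intro!: prob_space_return)
    ultimately show ?thesis
      by (intro that[of "return borel 0" "\<lambda>_. 0"]) auto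
  next
    case False
    with nonneg have pos: "0 < L 1" by simp
    define w where "w m k = L (\<Prod>i\<in>UNIV. bernstein m (k i) (unit_coord r i)) / L 1" for m and k :: "'n \<Rightarrow> nat"
    \<comment> \<open>For \<open>m = 0\<close> the division by zero yields \<open>0\<close>, so the single grid point is the origin.\<close>
    define g :: "nat \<Rightarrow> ('n \<Rightarrow> nat) \<Rightarrow> real ^ 'n" where "g m k = (\<chi> i. real (k i) / real m)" for m k
    define A :: "nat \<Rightarrow> ('n \<Rightarrow> nat) set" where "A m = PiE UNIV (\<lambda>_. {..m})" for m
    have fin: "finite (A m)" for m unfolding A_def by (intro finite_PiE) auto
    have w: "0 \<le> w m k" if "k \<in> A m" for m k
      using bernstein_nonneg[OF L r] pos by (simp add: w_def)
    have total: "(\<Sum>k\<in>A m. w m k) = 1" for m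
      using bernstein_functional_moment[OF lin, of "\<lambda>_. 0" m r] pos
      by (simp add: w_def A_def flip: sum_divide_distrib)
    have g: "g m k \<in> unit_cube" if "k \<in> A m" for m k
    proof -
      have "k i \<le> m" for i using that by (auto simp: A_def)
      thus ?thesis by (auto simp: g_def divide_le_eq_1)
    qed
    show ?thesis
    proof (rule convergent_subsequence_of_point_measures[of A w g, OF fin w total g])
      fix \<rho> :: "nat \<Rightarrow> nat" and M :: "real measure" and \<phi> :: "real \<Rightarrow> real ^ 'n"
      assume \<rho>: "strict_mono \<rho>" and M: "real_distribution M"
        and \<phi>: "continuous_on UNIV \<phi>" "range \<phi> \<subseteq> unit_cube"
        and lim: "\<And>F :: real ^ 'n \<Rightarrow> real. continuous_on unit_cube F \<Longrightarrow>
          (\<lambda>j. \<Sum>k\<in>A (\<rho> j). w (\<rho> j) k * F (g (\<rho> j) k)) \<longlonglongrightarrow> (\<integral>t. F (\<phi> t) \<partial>M)"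
      show ?thesis
      proof (rule that[OF M \<phi>])
        fix a :: "'n \<Rightarrow> nat"
        let ?I = "\<integral>t. (\<Prod>i\<in>UNIV. (\<phi> t $ i) ^ a i) \<partial>M"
        let ?S = "\<lambda>m. \<Sum>k\<in>A m. w m k * (\<Prod>i\<in>UNIV. (g m k $ i) ^ a i)"
        have "(\<lambda>j. ?S (\<rho> j)) \<longlonglongrightarrow> ?I"
          by (rule lim) (intro continuous_intros)
        moreover have "?S \<longlonglongrightarrow> L (\<Prod>i\<in>UNIV. unit_coord r i ^ a i) / L 1"
          using tendsto_divide[OF bernstein_grid_moment_tendsto[OF L r, of a] tendsto_const[of "L 1"]] pos
          by (simp add: A_def w_def g_def sum_divide_distrib)
        hence "(\<lambda>j. ?S (\<rho> j)) \<longlonglongrightarrow> L (\<Prod>i\<in>UNIV. unit_coord r i ^ a i) / L 1"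
          using LIMSEQ_subseq_LIMSEQ[OF _ \<rho>] by (simp add: o_def)
        ultimately have "L (\<Prod>i\<in>UNIV. unit_coord r i ^ a i) / L 1 = ?I"
          by (rule LIMSEQ_unique[rotated])
        thus "L (\<Prod>i\<in>UNIV. unit_coord r i ^ a i) = L 1 * ?I" using pos by (simp add: field_simps)
      qed
    qed
  qed
qed

lemma integrable_continuous_on_unit_cube:
  fixes h :: "real ^ 'n::finite \<Rightarrow> real"
  assumes M: "real_distribution M" and \<phi>: "continuous_on UNIV \<phi>" "range \<phi> \<subseteq> unit_cube"
    and h: "continuous_on UNIV h"
  shows "integrable M (\<lambda>t. h (\<phi> t))"
proof -
  interpret real_distribution M by (rule M)
  from compact_imp_bounded[OF compact_continuous_image[OF continuous_on_subset[OF h subset_UNIV] compact_unit_cube]]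
  obtain K where K: "\<And>y. y \<in> unit_cube \<Longrightarrow> norm (h y) \<le> K" by (auto simp: bounded_iff)
  have "(\<lambda>t. h (\<phi> t)) \<in> borel_measurable borel"
    by (intro borel_measurable_continuous_onI continuous_on_compose2[OF h \<phi>(1)]) auto
  hence "(\<lambda>t. h (\<phi> t)) \<in> borel_measurable M" by simp
  moreover have "norm (h (\<phi> t)) \<le> K" for t using \<phi>(2) by (intro K) auto
  ultimately show ?thesis by (intro integrable_const_bound[of _ K] AE_I2)
qed

lemma prod_power_fun_upd_Suc:
  fixes z :: "'n::finite \<Rightarrow> 'a::comm_monoid_mult"
  shows "(\<Prod>j\<in>UNIV. z j ^ (a(i := Suc (a i))) j) = z i * (\<Prod>j\<in>UNIV. z j ^ a j)"
  by (simp add: prod.remove[of UNIV i] mult.assoc)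

text \<open>
  The moments of the \<open>T\<^sub>i\<close> are known. To pass to arbitrary polynomials, one considers all \<open>f\<close> for which
  \<open>L(f T\<^sup>a)\<close> is the corresponding integral for every exponent \<open>a\<close>. Letting \<open>a\<close> vary makes this class
  closed under multiplication by \<open>X\<^sub>i = 2 r\<^sub>i T\<^sub>i - r\<^sub>i\<close>, so it contains all monomials.
\<close>

lemma psd_imp_represented:
  fixes r :: "real ^ 'n::finite"
  assumes L: "bounded_psd r L" and r: "\<And>i. 0 < r $ i"
  shows "\<exists>\<mu>. represents_on L {x. \<forall>i. x $ i \<in> {- (r $ i) .. r $ i}} \<mu>"
proof -
  have lin: "linear_functional L" and psd: "psd_functional L" using L by (auto simp: bounded_psd_def)
  have nonneg: "0 \<le> L 1" using psd[unfolded psd_functional_def, rule_format, of 1] by simp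
  obtain M :: "real measure" and \<phi> :: "real \<Rightarrow> real ^ 'n"
    where M: "real_distribution M" and \<phi>: "continuous_on UNIV \<phi>" "range \<phi> \<subseteq> unit_cube"
      and mom: "\<And>a. L (\<Prod>i\<in>UNIV. unit_coord r i ^ a i) = L 1 * (\<integral>t. (\<Prod>i\<in>UNIV. (\<phi> t $ i) ^ a i) \<partial>M)"
    by (rule unit_coord_moments_representation[OF L r]) blast
  interpret real_distribution M by (rule M)
  \<comment> \<open>\<open>\<psi>\<close> maps the cube onto the box and inverts the \<open>T\<^sub>i\<close>. \<open>U a\<close> is the function of which \<open>T a\<close> is the
    polynomial in these coordinates.\<close>
  define \<psi> where "\<psi> y = (\<chi> i. r $ i * (2 * (y $ i) - 1))" for y :: "real ^ 'n"
  define U :: "('n \<Rightarrow> nat) \<Rightarrow> real ^ 'n \<Rightarrow> real" where "U a y = (\<Prod>i\<in>UNIV. (y $ i) ^ a i)" for a y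
  define T where "T a = (\<Prod>i\<in>UNIV. unit_coord r i ^ a i)" for a :: "'n \<Rightarrow> nat"
  have \<psi>: "continuous_on UNIV \<psi>" unfolding \<psi>_def by (intro continuous_intros continuous_on_vec_lambda)
  have cont: "continuous_on UNIV (\<lambda>y. poly_eval f (\<psi> y) * U a y)" for f a
    unfolding U_def
    by (intro continuous_intros continuous_on_compose2[OF continuous_on_poly_eval \<psi>]) auto
  have int: "integrable M (\<lambda>t. poly_eval f (\<psi> (\<phi> t)) * U a (\<phi> t))" for f a
    by (rule integrable_continuous_on_unit_cube[OF M \<phi> cont])

  define rep where "rep f \<longleftrightarrow> (\<forall>a. L (f * T a) = L 1 * (\<integral>t. poly_eval f (\<psi> (\<phi> t)) * U a (\<phi> t) \<partial>M))" for f
  have rep_1: "rep 1" unfolding rep_def using mom by (simp add: poly_eval_1 T_def U_def)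
  have rep_add: "rep (p + q)" if "rep p" "rep q" for p q
    using that int unfolding rep_def
    by (simp add: distrib_right linear_functionalD[OF lin] poly_eval_add distrib_left)
  have rep_scale: "rep (poly_scale c p)" if "rep p" for c p
    using that unfolding rep_def
    by (simp add: poly_scale_times linear_functionalD[OF lin] poly_eval_scale mult.assoc)
  have rep_coord: "rep (coord i * f)" if f: "rep f" for i f
    unfolding rep_def
  proof
    fix a :: "'n \<Rightarrow> nat"
    let ?a = "a(i := Suc (a i))"
    have coord_eq: "coord i = poly_scale (2 * r $ i) (unit_coord r i) - poly_scale (r $ i) 1"
      using r[of i] by (intro poly_mapping_eqI)
        (simp add: unit_coord_def lookup_minus lookup_poly_scale lookup_add algebra_simps)
    have "coord i * f * T a = poly_scale (2 * r $ i) (f * T ?a) - poly_scale (r $ i) (f * T a)"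
      unfolding coord_eq T_def prod_power_fun_upd_Suc
      by (simp add: left_diff_distrib right_diff_distrib poly_scale_times times_poly_scale mult_ac)
    hence "L (coord i * f * T a) = 2 * r $ i * L (f * T ?a) - r $ i * L (f * T a)"
      by (simp add: linear_functionalD[OF lin])
    also have "\<dots> = L 1 * (2 * r $ i * (\<integral>t. poly_eval f (\<psi> (\<phi> t)) * U ?a (\<phi> t) \<partial>M)
        - r $ i * (\<integral>t. poly_eval f (\<psi> (\<phi> t)) * U a (\<phi> t) \<partial>M))"
      using f by (simp add: rep_def algebra_simps)
    also have "2 * r $ i * (\<integral>t. poly_eval f (\<psi> (\<phi> t)) * U ?a (\<phi> t) \<partial>M)
        - r $ i * (\<integral>t. poly_eval f (\<psi> (\<phi> t)) * U a (\<phi> t) \<partial>M)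
        = (\<integral>t. 2 * r $ i * (poly_eval f (\<psi> (\<phi> t)) * U ?a (\<phi> t))
            - r $ i * (poly_eval f (\<psi> (\<phi> t)) * U a (\<phi> t)) \<partial>M)"
      by (subst Bochner_Integration.integral_diff) (simp_all add: int)
    also have "\<dots> = (\<integral>t. poly_eval (coord i * f) (\<psi> (\<phi> t)) * U a (\<phi> t) \<partial>M)"
      unfolding U_def prod_power_fun_upd_Suc
      by (intro Bochner_Integration.integral_cong refl)
         (simp add: poly_eval_mult poly_eval_coord \<psi>_def algebra_simps)
    finally show "L (coord i * f * T a) = L 1 * \<dots>" .
  qed
  have rep_coord_power: "rep (coord i ^ k * f)" if "rep f" for i k f
    using that by (induction k) (simp_all add: rep_coord mult.assoc)
  have "rep (\<Prod>i\<in>S. coord i ^ \<alpha> i)" for S and \<alpha> :: "'n \<Rightarrow> nat"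
    by (induction S rule: infinite_finite_induct) (simp_all add: rep_1 rep_coord_power)
  hence "rep (monomial \<alpha>)" for \<alpha> by (simp add: monomial_eq_prod_coord)
  hence rep: "rep f" for f
    by (induction f rule: rpoly_induct) (simp_all add: rep_add rep_scale)
  have L_eq: "L f = L 1 * (\<integral>t. poly_eval f (\<psi> (\<phi> t)) \<partial>M)" for f
    using rep[of f, unfolded rep_def, rule_format, of "\<lambda>_. 0"] by (simp add: T_def U_def)
  have int_eval: "integrable M (\<lambda>t. poly_eval f (\<psi> (\<phi> t)))" for f
    using int[of f "\<lambda>_. 0"] by (simp add: U_def)

  define K where "K = {x :: real ^ 'n. \<forall>i. x $ i \<in> {- (r $ i) .. r $ i}}"
  define N where "N = distr M (restrict_space borel K) (\<lambda>t. \<psi> (\<phi> t))"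
  \<comment> \<open>\<open>N\<close> is a probability measure, so the total mass has to be put back.\<close>
  define \<mu> where "\<mu> = density N (\<lambda>_. ennreal (L 1))"
  have "\<psi> (\<phi> t) \<in> K" for t
  proof -
    have "\<bar>2 * (\<phi> t $ i) - 1\<bar> \<le> 1" for i using subsetD[OF \<phi>(2) rangeI[of \<phi> t]] by (auto simp: abs_le_iff)
    hence "\<bar>r $ i * (2 * (\<phi> t $ i) - 1)\<bar> \<le> r $ i" for i
      using mult_left_mono[of _ 1 "r $ i"] r[of i] by (simp add: abs_mult)
    hence "\<bar>\<psi> (\<phi> t) $ i\<bar> \<le> r $ i" for i by (simp add: \<psi>_def)
    moreover have "x \<in> {- c..c}" if "\<bar>x\<bar> \<le> c" for x c :: real using that by auto
    ultimately show ?thesis by (simp only: K_def mem_Collect_eq simp_thms)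
  qed
  moreover have "(\<lambda>t. \<psi> (\<phi> t)) \<in> borel_measurable borel"
    by (intro borel_measurable_continuous_onI continuous_on_compose2[OF \<psi> \<phi>(1)]) auto
  ultimately have meas: "(\<lambda>t. \<psi> (\<phi> t)) \<in> measurable M (restrict_space borel K)"
    by (intro measurable_restrict_space2) auto
  have eval_meas: "poly_eval f \<in> borel_measurable (restrict_space borel K)" for f
    by (intro measurable_restrict_space1 borel_measurable_continuous_onI continuous_on_poly_eval)
  hence eval_meas_N: "poly_eval f \<in> borel_measurable N" for f by (simp add: N_def)
  have "integrable N (poly_eval f)" for f
    unfolding N_def by (subst integrable_distr_eq[OF meas eval_meas]) (rule int_eval)
  hence "integrable \<mu> (poly_eval f)" for f
    unfolding \<mu>_def using nonneg by (subst integrable_density) (auto intro: eval_meas_N)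
  moreover have "L f = (\<integral>x. poly_eval f x \<partial>\<mu>)" for f
  proof -
    have "(\<integral>x. poly_eval f x \<partial>\<mu>) = L 1 * (\<integral>x. poly_eval f x \<partial>N)"
      unfolding \<mu>_def using nonneg by (subst integral_density) (auto intro: eval_meas_N)
    also have "(\<integral>x. poly_eval f x \<partial>N) = (\<integral>t. poly_eval f (\<psi> (\<phi> t)) \<partial>M)"
      unfolding N_def by (rule integral_distr[OF meas eval_meas])
    finally show ?thesis unfolding L_eq[of f] by (rule sym)
  qed
  moreover have "sets \<mu> = sets (restrict_space borel K)" by (simp add: \<mu>_def N_def)
  ultimately have "represents_on L K \<mu>" by (simp add: represents_on_def)
  thus ?thesis unfolding K_def by (rule exI)
qed

lemma represented_imp_psd:
  assumes "represents_on L K \<mu>" shows "psd_functional L"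
proof -
  have "L f = (\<integral>x. poly_eval f x \<partial>\<mu>)" for f using assms by (simp add: represents_on_def)
  thus ?thesis
    by (simp add: psd_functional_def power2_eq_square poly_eval_mult Bochner_Integration.integral_nonneg)
qed

theorem theorem3p13:
  fixes r :: "real ^ 'n::finite"
    and L :: "'n rpoly \<Rightarrow> real"
  assumes r_pos: "\<And>i. r $ i > 0"
    and L_lin: "linear_functional L"
    and L_bdd: "bdd_above (range (\<lambda>\<alpha> :: 'n mindex.
      \<bar>L (monomial \<alpha>)\<bar> * (\<Prod>i\<in>UNIV. (r $ i) powi (- int (Poly_Mapping.lookup \<alpha> i)))))"
  shows "psd_functional L \<longleftrightarrow>
    (\<exists>\<mu> :: (real ^ 'n) measure. represents_on L {x. \<forall>i. x $ i \<in> {- (r $ i) .. r $ i}} \<mu>)"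
proof
  have pos: "0 < weight r \<alpha>" for \<alpha> unfolding weight_def using r_pos by (intro prod_pos) simp
  have inv: "(\<Prod>i\<in>UNIV. (r $ i) powi (- int (Poly_Mapping.lookup \<alpha> i))) = inverse (weight r \<alpha>)" for \<alpha> :: "'n mindex"
    by (simp add: weight_def power_int_minus prod_inversef[symmetric] o_def)
  from L_bdd obtain C where "\<bar>L (monomial \<alpha>)\<bar> * inverse (weight r \<alpha>) \<le> C" for \<alpha>
    unfolding inv by (auto simp: bdd_above_def)
  hence "\<bar>L (monomial \<alpha>)\<bar> / weight r \<alpha> \<le> C" for \<alpha> by (simp add: divide_inverse)
  hence "\<bar>L (monomial \<alpha>)\<bar> \<le> C * weight r \<alpha>" for \<alpha>
    using pos[of \<alpha>] pos_divide_le_eq by blast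
  hence growth: "growth_bounded r L" unfolding growth_bounded_def by blast
  show "\<exists>\<mu>. represents_on L {x. \<forall>i. x $ i \<in> {- (r $ i) .. r $ i}} \<mu>" if "psd_functional L"
    using that L_lin growth r_pos by (intro psd_imp_represented) (auto simp: bounded_psd_def)
qed (use represented_imp_psd in blast)

end
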